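(* Let $I$ be a closed interval in $\mathbb{R}$ with extreme points $a<b$, and let $m\in\mathbb{N}$ with $m\geq 2$. Let $f:I\to\mathbb{R}$ be a convex function of class $C^{m}$ in the interior of $I$, and assume that $f$ has one-sided derivatives of order up to $m$, denoted by $f^{(k)}(a^{+})$ or $f^{(k)}(b^{-})$, at the extreme points of $I$. Then $f$ has a convex extension of class $C^{m}(\mathbb{R})$ if and only if the first (if any) non-zero derivative which occurs in the finite sequence $\{f^{(2)}(b^{-}), f^{(3)}(b^{-}), \ldots, f^{(m)}(b^{-})\}$ is positive and of even order, and similarly for $\{f^{(2)}(a^{+}), f^{(3)}(a^{+}), \ldots, f^{(m)}(a^{+})\}$.
   Context: $f^{(k)}(a^{+})$ denotes the one-sided (right) derivative of order $k$ of $f$ at $a$, and $f^{(k)}(b^{-})$ the one-sided (left) derivative of order $k$ of $f$ at $b$. A convex extension of class $C^m(\mathbb{R})$ is a convex function $F\in C^m(\mathbb{R})$ with $F=f$ on $I$.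
   Formalization: The formal theorem also assumes that the m-th derivative of f is continuous up to a and b (f^(m)(x) tends to f^(m)(a+) and f^(m)(b-)); without this the claim fails, e.g. m=2, I=[0,1], f'(x)=x+x^2 sin(1/x)/10. Any C^m extension forces this continuity. *)

theory Defs
  imports "HOL-Analysis.Analysis"
begin

text \<open>
  Only meant for open \<open>S\<close>: the iterated \<^const>\<open>deriv\<close> is two-sided, so on an open set it
  depends only on the restriction of \<open>f\<close> to that set.
\<close>

definition C_class_on :: "nat \<Rightarrow> real set \<Rightarrow> (real \<Rightarrow> real) \<Rightarrow> bool" where
  "C_class_on m S f \<longleftrightarrow>
     (\<forall>k<m. \<forall>x\<in>S. (deriv ^^ k) f differentiable (at x)) \<and> continuous_on S ((deriv ^^ m) f)"

text \<open>
  The one-sided derivative of order \<open>k + 1\<close> at \<open>c\<close> is the one-sided limit of the difference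
  quotient of the \<open>k\<close>-th derivative, whose value at \<open>c\<close> itself is taken to be the one-sided
  derivative of order \<open>k\<close>. The side is given by \<open>S\<close>, which is \<open>{c<..}\<close> or \<open>{..<c}\<close>.
  The value is meaningful only if \<open>one_sided_derivs_exist\<close> holds up to that order.
\<close>

primrec one_sided_deriv :: "real set \<Rightarrow> (real \<Rightarrow> real) \<Rightarrow> nat \<Rightarrow> real \<Rightarrow> real" where
  "one_sided_deriv S f 0 c = f c"
| "one_sided_deriv S f (Suc k) c =
     Lim (at c within S) (\<lambda>x. ((deriv ^^ k) f x - one_sided_deriv S f k c) / (x - c))"

definition one_sided_derivs_exist :: "real set \<Rightarrow> (real \<Rightarrow> real) \<Rightarrow> nat \<Rightarrow> real \<Rightarrow> bool" where
  "one_sided_derivs_exist S f m c \<longleftrightarrow>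
     (\<forall>k<m. \<exists>l. ((\<lambda>x. ((deriv ^^ k) f x - one_sided_deriv S f k c) / (x - c)) \<longlongrightarrow> l)
        (at c within S))"

abbreviation right_deriv :: "(real \<Rightarrow> real) \<Rightarrow> nat \<Rightarrow> real \<Rightarrow> real" where
  "right_deriv f k c \<equiv> one_sided_deriv {c<..} f k c"

abbreviation left_deriv :: "(real \<Rightarrow> real) \<Rightarrow> nat \<Rightarrow> real \<Rightarrow> real" where
  "left_deriv f k c \<equiv> one_sided_deriv {..<c} f k c"

abbreviation right_derivs_exist :: "(real \<Rightarrow> real) \<Rightarrow> nat \<Rightarrow> real \<Rightarrow> bool" where
  "right_derivs_exist f m c \<equiv> one_sided_derivs_exist {c<..} f m c"

abbreviation left_derivs_exist :: "(real \<Rightarrow> real) \<Rightarrow> nat \<Rightarrow> real \<Rightarrow> bool" where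
  "left_derivs_exist f m c \<equiv> one_sided_derivs_exist {..<c} f m c"

text \<open>
  The existence of one-sided derivatives of order up to \<open>m\<close> makes the derivatives of order less
  than \<open>m\<close> continuous up to the endpoint, but not the \<open>m\<close>-th one. Being of class \<open>C\<^sup>m\<close> up to the
  endpoint needs the following in addition. It cannot be dropped from the theorem: the primitive
  of \<open>x + x\<^sup>2 sin (1/x) / 10\<close> on \<open>[0, 1]\<close> is convex with second right derivative \<open>1\<close> at \<open>0\<close>, but its
  second derivative has no limit there, so it has no \<open>C\<^sup>2\<close> extension.
\<close>

definition right_deriv_continuous :: "(real \<Rightarrow> real) \<Rightarrow> nat \<Rightarrow> real \<Rightarrow> bool" where
  "right_deriv_continuous f m c \<longleftrightarrow> ((deriv ^^ m) f \<longlongrightarrow> right_deriv f m c) (at_right c)"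

definition left_deriv_continuous :: "(real \<Rightarrow> real) \<Rightarrow> nat \<Rightarrow> real \<Rightarrow> bool" where
  "left_deriv_continuous f m c \<longleftrightarrow> ((deriv ^^ m) f \<longlongrightarrow> left_deriv f m c) (at_left c)"

definition first_nonzero_pos_even :: "nat \<Rightarrow> (nat \<Rightarrow> real) \<Rightarrow> bool" where
  "first_nonzero_pos_even m d \<longleftrightarrow>
     (\<forall>k\<in>{2..m}. d k \<noteq> 0 \<and> (\<forall>j\<in>{2..<k}. d j = 0) \<longrightarrow> d k > 0 \<and> even k)"

end

theory Submission
  imports Defs "HOL-Computational_Algebra.Polynomial"
begin

text \<open>
  A convex \<open>C\<^sup>m\<close> function \<open>F\<close> on the line has \<open>F'' \<ge> 0\<close>. If the first non-vanishing derivative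
  of \<open>F\<close> at \<open>c\<close> of order at least two has order \<open>k \<le> m\<close>, then Taylor's theorem for \<open>F''\<close> shows that
  \<open>F''(x)\<close> behaves near \<open>c\<close> like \<open>F\<^sup>(\<^sup>k\<^sup>)(c) (x - c)\<^sup>k\<^sup>-\<^sup>2 / (k - 2)!\<close>. This can be nonnegative on both sides
  of \<open>c\<close> only if \<open>k\<close> is even and the coefficient positive
  (\<open>nonneg_imp_first_nonzero_derivative_pos_even\<close>). The derivatives of an extension at the end points are the
  one-sided derivatives of \<open>f\<close>, so the condition is necessary.

  Conversely, \<open>f\<close> is continued beyond \<open>b\<close> by its Taylor polynomial \<open>T\<close> of order \<open>m\<close> at \<open>b\<close>, corrected by
  a multiple of \<open>(x - b)\<^sup>m\<^sup>+\<^sup>1\<close>, which changes no derivative of order up to \<open>m\<close> at \<open>b\<close>. As the first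
  coefficient of \<open>T''\<close> that does not vanish, if any, is positive, \<open>T''\<close> is nonnegative on some \<open>[b, b + \<delta>]\<close>. Further to the right, the
  correction contributes a large multiple of \<open>(x - b)\<^sup>m\<^sup>-\<^sup>1\<close>, which dominates \<open>T''\<close> because
  \<open>T''\<close> has degree at most \<open>m - 2\<close> (\<open>poly_add_power_nonneg\<close>). So the continuation is convex on all of
  \<open>[b, \<infinity>)\<close>. The left end follows by reflection, which multiplies the \<open>k\<close>-th derivative by \<open>(-1)\<^sup>k\<close>; this
  is where evenness of the order enters. Because all derivatives up to order \<open>m\<close> match at \<open>a\<close> and \<open>b\<close>,
  the three pieces form a \<open>C\<^sup>m\<close> function (\<open>jet_on_glue\<close>) with nonnegative second derivative.
\<close>

section \<open>Jets\<close>

text \<open>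
  A function together with its derivatives up to order \<open>m\<close>. Listing the derivatives explicitly, and
  taking them within \<open>S\<close>, makes sense of \<open>C\<^sup>m\<close> functions on closed intervals, where the iterated
  two-sided derivative says nothing at the end points.
\<close>

definition jet_on :: "nat \<Rightarrow> real set \<Rightarrow> (nat \<Rightarrow> real \<Rightarrow> real) \<Rightarrow> bool" where
  "jet_on m S G \<longleftrightarrow>
     (\<forall>k<m. \<forall>x\<in>S. (G k has_real_derivative G (Suc k) x) (at x within S)) \<and> continuous_on S (G m)"

lemma jet_onD: "jet_on m S G \<Longrightarrow> k < m \<Longrightarrow> x \<in> S \<Longrightarrow>
    (G k has_real_derivative G (Suc k) x) (at x within S)"
  by (simp add: jet_on_def)

lemma jet_on_continuous:
  assumes "jet_on m S G" "k \<le> m"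
  shows "continuous_on S (G k)"
proof (cases "k = m")
  case False
  then show ?thesis
    using assms jet_onD[OF assms(1), of k]
    by (meson DERIV_continuous continuous_on_eq_continuous_within le_neq_implies_less)
qed (use assms in \<open>simp add: jet_on_def\<close>)

lemma jet_on_subset: "jet_on m S G \<Longrightarrow> T \<subseteq> S \<Longrightarrow> jet_on m T G"
  unfolding jet_on_def by (meson DERIV_subset continuous_on_subset subsetD)

lemma jet_on_shift: "jet_on (i + n) S G \<Longrightarrow> jet_on n S (\<lambda>k. G (i + k))"
  unfolding jet_on_def by auto

lemma jet_on_UNIV_deriv:
  assumes "jet_on m UNIV G" "k \<le> m"
  shows "(deriv ^^ k) (G 0) = G k"
  using assms(2)
proof (induction k)
  case (Suc k)
  then show ?case
    using DERIV_imp_deriv[OF jet_onD[OF assms(1), of k, simplified]] by auto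
qed simp

lemma jet_on_UNIV_imp_C_class: "jet_on m UNIV G \<Longrightarrow> C_class_on m UNIV (G 0)"
  using jet_on_UNIV_deriv[of m G]
  by (auto simp: C_class_on_def jet_on_def real_differentiable_def)

lemma C_class_imp_jet_on:
  assumes "C_class_on m S f" "open S"
  shows "jet_on m S (\<lambda>k. (deriv ^^ k) f)"
  using assms DERIV_deriv_iff_real_differentiable
  by (auto simp: C_class_on_def jet_on_def at_within_open_NO_MATCH)

text \<open>
  This identifies the derivatives of an extension at \<open>a\<close> and \<open>b\<close> with the one-sided derivatives of the
  given function: both families are jets of the same function on \<open>{a..b}\<close>, and derivatives within a
  nondegenerate interval are unique, also at its end points.
\<close>

lemma jet_on_Icc_unique:
  assumes G: "jet_on m {a..b} G" and H: "jet_on m {a..b} H"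
    and "a < b" and eq: "\<And>x. x \<in> {a..b} \<Longrightarrow> G 0 x = H 0 x"
    and "k \<le> m" "x \<in> {a..b}"
  shows "G k x = H k x"
  using \<open>k \<le> m\<close> \<open>x \<in> {a..b}\<close>
proof (induction k arbitrary: x)
  case (Suc k)
  have "(G k has_vector_derivative G (Suc k) x) (at x within {a..b})"
    using jet_onD[OF G] Suc.prems by (simp add: has_real_derivative_iff_has_vector_derivative)
  moreover have "(H k has_vector_derivative H (Suc k) x) (at x within {a..b})"
    using jet_onD[OF H] Suc.prems by (simp add: has_real_derivative_iff_has_vector_derivative)
  then have "(G k has_vector_derivative H (Suc k) x) (at x within {a..b})"
    by (rule has_vector_derivative_transform[rotated 2]) (use Suc in auto)
  moreover have "at x within {a..b} \<noteq> bot"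
    using \<open>a < b\<close> Suc.prems by (simp add: trivial_limit_within)
  ultimately show ?case
    by (blast intro: vector_derivative_unique_within)
qed (use eq in simp)

text \<open>
  At a common point the derivatives within the two pieces agree, so they combine to a derivative within
  the union. At a point of one piece only, the other piece is closed and thus stays away from it, and
  the derivative condition within that other piece is vacuous.
\<close>

lemma jet_on_glue:
  assumes G: "jet_on m S G" and H: "jet_on m T H" and cl: "closed S" "closed T"
    and eq: "\<And>k x. k \<le> m \<Longrightarrow> x \<in> S \<Longrightarrow> x \<in> T \<Longrightarrow> G k x = H k x"
  shows "jet_on m (S \<union> T) (\<lambda>k x. if x \<in> S then G k x else H k x)" (is "jet_on _ _ ?J")
  unfolding jet_on_def
proof (intro conjI allI ballI impI)
  fix k x assume k: "k < m" and x: "x \<in> S \<union> T"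
  have "(?J k has_real_derivative ?J (Suc k) x) (at x within S)"
  proof (cases "x \<in> S")
    case True
    then show ?thesis
      using has_field_derivative_transform_within[OF jet_onD[OF G k True], of 1 "?J k"] by simp
  next
    case False
    then show ?thesis
      using not_in_closure_trivial_limitI[of x S] cl by (simp add: has_field_derivative_iff)
  qed
  moreover have "(?J k has_real_derivative ?J (Suc k) x) (at x within T)"
  proof (cases "x \<in> T")
    case True
    have "H (Suc k) x = ?J (Suc k) x"
      using eq k True by simp
    then show ?thesis
      using has_field_derivative_transform_within[OF jet_onD[OF H k True], of 1 "?J k"] eq[of k] k True
      by simp
  next
    case False
    then show ?thesis
      using not_in_closure_trivial_limitI[of x T] cl by (simp add: has_field_derivative_iff)
  qed
  ultimately show "(?J k has_real_derivative ?J (Suc k) x) (at x within (S \<union> T))"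
    unfolding has_field_derivative_iff unfolding at_within_union by (rule filterlim_sup)
next
  show "continuous_on (S \<union> T) (?J m)"
    using G H cl eq[of m] by (intro continuous_on_If) (auto simp: jet_on_def)
qed

lemma jet_on_poly: "jet_on m S (\<lambda>k x. poly ((pderiv ^^ k) P) (x - c))"
  by (auto simp: jet_on_def intro!: derivative_eq_intros continuous_intros)

lemma jet_on_reflect:
  assumes "jet_on m UNIV G"
  shows "jet_on m UNIV (\<lambda>k x. (-1) ^ k * G k (- x))"
  unfolding jet_on_def
proof (intro conjI allI ballI impI)
  fix k x assume "k < m"
  have "((\<lambda>x. G k (- x)) has_real_derivative G (Suc k) (- x) * (- 1)) (at x)"
    using jet_onD[OF assms \<open>k < m\<close>, of "- x"] by (intro DERIV_chain2) (auto intro!: derivative_eq_intros)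
  then show "((\<lambda>x. (-1) ^ k * G k (- x)) has_real_derivative (-1) ^ Suc k * G (Suc k) (- x)) (at x)"
    by (auto intro!: derivative_eq_intros)
next
  have "continuous_on UNIV (\<lambda>x. G m (- x))"
    using assms by (auto simp: jet_on_def intro!: continuous_on_compose2[of UNIV "G m"] continuous_intros)
  then show "continuous_on UNIV (\<lambda>x. (-1) ^ m * G m (- x))"
    by (intro continuous_intros)
qed

section \<open>One-sided derivatives at the end points\<close>

lemma one_sided_deriv_tendsto:
  assumes "one_sided_derivs_exist S f m c" "k < m" "at c within S \<noteq> bot"
  shows "((\<lambda>x. ((deriv ^^ k) f x - one_sided_deriv S f k c) / (x - c))
           \<longlongrightarrow> one_sided_deriv S f (Suc k) c) (at c within S)"
  using assms tendsto_Lim by (fastforce simp: one_sided_derivs_exist_def)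

definition closed_interval_jet :: "(real \<Rightarrow> real) \<Rightarrow> real \<Rightarrow> real \<Rightarrow> nat \<Rightarrow> real \<Rightarrow> real" where
  "closed_interval_jet f a b k x =
     (if x = a then right_deriv f k a else if x = b then left_deriv f k b else (deriv ^^ k) f x)"

text \<open>
  The recursive one-sided derivatives are limits of difference quotients of exactly this family, whose
  value at an end point is the previous one-sided derivative. Their existence gives the derivatives at the end
  points, and the convergence of the top derivative gives its continuity there.
\<close>

lemma jet_on_closed_interval_jet:
  assumes "a < b" and C: "C_class_on m {a<..<b} f"
    and ra: "right_derivs_exist f m a" "right_deriv_continuous f m a"
    and lb: "left_derivs_exist f m b" "left_deriv_continuous f m b"
  shows "jet_on m {a..b} (closed_interval_jet f a b)" (is "jet_on _ _ ?D")
proof -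
  have ev_a: "\<forall>\<^sub>F x in at_right a. ?D k x = (deriv ^^ k) f x" for k
    using eventually_at_right_field[of _ a] \<open>a < b\<close>
    by (auto simp: closed_interval_jet_def intro!: exI[of _ b])
  have ev_b: "\<forall>\<^sub>F x in at_left b. ?D k x = (deriv ^^ k) f x" for k
    using eventually_at_left_field[of _ b] \<open>a < b\<close>
    by (auto simp: closed_interval_jet_def intro!: exI[of _ a])
  have ev_i: "\<forall>\<^sub>F y in nhds x. ?D k y = (deriv ^^ k) f y" if "x \<in> {a<..<b}" for k x
    using eventually_nhds_in_open[OF _ that] by (auto simp: closed_interval_jet_def elim: eventually_mono)
  have der: "(?D k has_real_derivative ?D (Suc k) x) (at x within {a..b})"
    if k: "k < m" and x: "x \<in> {a..b}" for k x
  proof -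
    consider "x = a" | "x = b" | "x \<in> {a<..<b}" using x by fastforce
    then show ?thesis
    proof cases
      case 1
      have "((\<lambda>y. (?D k y - ?D k a) / (y - a)) \<longlongrightarrow> right_deriv f (Suc k) a) (at_right a)"
        using one_sided_deriv_tendsto[OF ra(1) k trivial_limit_at_right_real]
      proof (rule Lim_transform_eventually)
        show "\<forall>\<^sub>F y in at_right a. ((deriv ^^ k) f y - right_deriv f k a) / (y - a)
                = (?D k y - ?D k a) / (y - a)"
          using ev_a[of k] by eventually_elim (simp add: closed_interval_jet_def)
      qed
      then show ?thesis
        using 1 \<open>a < b\<close>
        by (simp add: closed_interval_jet_def[of f a b "Suc k" a] has_field_derivative_iff at_within_Icc_at_right)
    next
      case 2
      have "((\<lambda>y. (?D k y - ?D k b) / (y - b)) \<longlongrightarrow> left_deriv f (Suc k) b) (at_left b)"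
        using one_sided_deriv_tendsto[OF lb(1) k trivial_limit_at_left_real]
      proof (rule Lim_transform_eventually)
        show "\<forall>\<^sub>F y in at_left b. ((deriv ^^ k) f y - left_deriv f k b) / (y - b)
                = (?D k y - ?D k b) / (y - b)"
          using ev_b[of k] by eventually_elim (use \<open>a < b\<close> in \<open>simp add: closed_interval_jet_def\<close>)
      qed
      then show ?thesis
        using 2 \<open>a < b\<close>
        by (simp add: closed_interval_jet_def[of f a b "Suc k" b] has_field_derivative_iff at_within_Icc_at_left)
    next
      case 3
      then have "((deriv ^^ k) f has_real_derivative (deriv ^^ Suc k) f x) (at x)"
        using jet_onD[OF C_class_imp_jet_on[OF C] k] by (simp add: at_within_open_NO_MATCH)
      moreover have "(deriv ^^ Suc k) f x = ?D (Suc k) x"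
        using 3 by (simp add: closed_interval_jet_def)
      ultimately have "(?D k has_real_derivative ?D (Suc k) x) (at x)"
        unfolding DERIV_cong_ev[OF refl ev_i[OF 3, of k] refl] by simp
      then show ?thesis
        by (rule has_field_derivative_at_within)
    qed
  qed
  have "continuous_on {a..b} (?D m)"
  proof (rule continuous_on_IccI)
    show "(?D m \<longlongrightarrow> ?D m a) (at_right a)"
      using ra(2) unfolding tendsto_cong[OF ev_a[of m]]
      by (simp add: right_deriv_continuous_def closed_interval_jet_def)
    show "(?D m \<longlongrightarrow> ?D m b) (at_left b)"
      using lb(2) \<open>a < b\<close> unfolding tendsto_cong[OF ev_b[of m]]
      by (simp add: left_deriv_continuous_def closed_interval_jet_def)
  next
    fix x assume "a < x" "x < b"
    then have x: "x \<in> {a<..<b}" by simp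
    have "isCont ((deriv ^^ m) f) x"
      using C x by (auto simp: C_class_on_def continuous_on_eq_continuous_at)
    then have "isCont (?D m) x"
      using isCont_cong[OF ev_i[OF x, of m]] by simp
    then show "?D m \<midarrow>x\<rightarrow> ?D m x"
      by (simp add: isCont_def)
  qed (use \<open>a < b\<close> in auto)
  with der show ?thesis
    by (simp add: jet_on_def)
qed

section \<open>Necessity: the sign of the first non-zero derivative\<close>

text \<open>
  Adding the inequalities for the tangents at two points shows that the first derivative is monotone.
\<close>

lemma convex_on_imp_second_deriv_nonneg:
  fixes f :: "real \<Rightarrow> real"
  assumes "open S" "convex_on S f"
    and f': "\<And>x. x \<in> S \<Longrightarrow> (f has_real_derivative f' x) (at x)"
    and f'': "(f' has_real_derivative f'') (at x)" and "x \<in> S"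
  shows "f'' \<ge> 0"
proof -
  have S: "connected S"
    using \<open>convex_on S f\<close> by (simp add: convex_connected convex_on_imp_convex)
  have tangent: "f' u * (v - u) \<le> f v - f u" if "u \<in> S" "v \<in> S" for u v
    using convex_on_imp_above_tangent[of S f u v "f' u"] assms(1,2) S f'[OF that(1)] that
    by (simp add: interior_open at_within_open_NO_MATCH)
  have "mono_on S f'"
  proof (rule mono_onI)
    fix u v assume uv: "u \<in> S" "v \<in> S" "u \<le> v"
    have "(f' v - f' u) * (v - u) \<ge> 0"
      using tangent[of u v] tangent[of v u] uv by (simp add: algebra_simps)
    then show "f' u \<le> f' v"
      using uv(3) by (cases "u = v") (auto simp: zero_le_mult_iff)
  qed
  then show ?thesis
    using mono_on_imp_deriv_nonneg[OF _ f''] assms(1,5) by (simp add: interior_open)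
qed

text \<open>
  Taylor's theorem with the Lagrange remainder, for a function whose Taylor polynomial below order
  \<open>i\<close> vanishes. The bound on \<open>t\<close> is kept symmetric so that both sides of \<open>c\<close> are covered at once.
\<close>

lemma jet_lagrange_after_zeros:
  assumes H: "jet_on n UNIV H" and "i \<le> n" and zero: "\<And>j. j < i \<Longrightarrow> H j c = 0" and "x \<noteq> c"
  obtains t where "\<bar>t - c\<bar> \<le> \<bar>x - c\<bar>" "H 0 x = H i t / fact i * (x - c) ^ i"
proof (cases "i = 0")
  case True
  then show ?thesis using that[of x] by simp
next
  case False
  have der: "\<forall>m t. m < i \<and> min x c \<le> t \<and> t \<le> max x c \<longrightarrow> DERIV (H m) t :> H (Suc m) t"
    using jet_onD[OF H] \<open>i \<le> n\<close> by auto
  show ?thesis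
  proof (cases "x < c")
    case True
    obtain t where "x < t" "t < c"
      "H 0 x = (\<Sum>m<i. H m c / fact m * (x - c)^m) + H i t / fact i * (x - c)^i"
      using Taylor_down[of i H "H 0" x c c] False True der by (auto simp: min_def max_def)
    then show ?thesis using that[of t] zero by simp
  next
    case notless: False
    obtain t where "c < t" "t < x"
      "H 0 x = (\<Sum>m<i. H m c / fact m * (x - c)^m) + H i t / fact i * (x - c)^i"
      using Taylor_up[of i H "H 0" c x c] False notless \<open>x \<noteq> c\<close> der by (auto simp: min_def max_def)
    then show ?thesis using that[of t] zero by simp
  qed
qed

text \<open>
  Near \<open>c\<close> the remainder \<open>H i t (x - c)\<^sup>i / i!\<close> has the sign of \<open>H i c (x - c)\<^sup>i\<close>, by continuity of
  \<open>H i\<close>. A point on the right of \<open>c\<close> then forces \<open>H i c > 0\<close>, and a point on the left forces \<open>i\<close> to be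
  even.
\<close>

lemma nonneg_imp_first_nonzero_derivative_pos_even:
  assumes H: "jet_on n UNIV H" and nonneg: "\<And>x. H 0 x \<ge> 0"
    and "i \<le> n" and zero: "\<And>j. j < i \<Longrightarrow> H j c = 0" and nz: "H i c \<noteq> 0"
  shows "H i c > 0 \<and> even i"
proof -
  have "isCont (H i) c"
    using jet_on_continuous[OF H \<open>i \<le> n\<close>] by (simp add: continuous_on_eq_continuous_at)
  moreover have "\<bar>H i c\<bar> > 0"
    using nz by simp
  ultimately obtain d where d: "d > 0" "\<And>t. \<bar>t - c\<bar> < d \<Longrightarrow> \<bar>H i t - H i c\<bar> < \<bar>H i c\<bar>"
    unfolding continuous_at_eps_delta dist_real_def by blast
  have sign: "H i c * (x - c) ^ i > 0" if "x \<noteq> c" "\<bar>x - c\<bar> < d" for x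
  proof -
    obtain t where t: "\<bar>t - c\<bar> \<le> \<bar>x - c\<bar>" "H 0 x = H i t / fact i * (x - c) ^ i"
      using jet_lagrange_after_zeros[OF H \<open>i \<le> n\<close> zero \<open>x \<noteq> c\<close>] by blast
    have same: "H i t * H i c > 0"
      using d(2)[of t] t(1) that nz by (auto simp: abs_if zero_less_mult_iff split: if_splits)
    have "H i t * (x - c) ^ i = H 0 x * fact i"
      using t(2) by simp
    then have "H i t * (x - c) ^ i \<ge> 0"
      using nonneg[of x] by simp
    moreover have "(x - c) ^ i \<noteq> 0" using that by simp
    ultimately show ?thesis
      using same by (metis less_eq_real_def mult_less_0_iff not_less zero_less_mult_iff)
  qed
  have "H i c > 0"
    using sign[of "c + d / 2"] d(1) by (simp add: zero_less_mult_iff)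
  moreover have "even i"
  proof (rule ccontr)
    assume "odd i"
    then have "(c - d / 2 - c) ^ i < 0"
      using d(1) by (simp only: power_less_zero_eq) simp
    then show False
      using sign[of "c - d / 2"] d(1) \<open>H i c > 0\<close> mult_pos_neg[of "H i c"] by fastforce
  qed
  ultimately show ?thesis by simp
qed

lemma convex_imp_first_nonzero_pos_even:
  assumes "m \<ge> 2" "convex_on UNIV F" "C_class_on m UNIV F"
  shows "first_nonzero_pos_even m (\<lambda>k. (deriv ^^ k) F c)"
  unfolding first_nonzero_pos_even_def
proof (intro ballI impI, elim conjE)
  fix k assume k: "k \<in> {2..m}" "(deriv ^^ k) F c \<noteq> 0" "\<forall>j\<in>{2..<k}. (deriv ^^ j) F c = 0"
  let ?J = "\<lambda>k. (deriv ^^ k) F"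
  have J: "jet_on m UNIV ?J"
    by (rule C_class_imp_jet_on[OF assms(3)]) simp
  have "?J 2 x \<ge> 0" for x
    using convex_on_imp_second_deriv_nonneg[OF open_UNIV assms(2), of "?J 1" "?J 2 x" x]
      jet_onD[OF J, of 0] jet_onD[OF J, of 1] \<open>m \<ge> 2\<close> by (simp add: numeral_2_eq_2)
  moreover have "jet_on (m - 2) UNIV (\<lambda>k. ?J (2 + k))"
    by (rule jet_on_shift) (use J \<open>m \<ge> 2\<close> in \<open>simp only: le_add_diff_inverse\<close>)
  moreover obtain i where "k = 2 + i"
    using k(1) le_Suc_ex[of 2 k] by auto
  ultimately show "?J k c > 0 \<and> even k"
    using nonneg_imp_first_nonzero_derivative_pos_even[of "m - 2" "\<lambda>k. ?J (2 + k)" i c] k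
    by (simp del: funpow.simps add_2_eq_Suc)
qed

section \<open>Sufficiency: convex polynomial continuations\<close>

text \<open>
  For \<open>i \<le> n\<close> and \<open>t \<ge> d\<close> each monomial satisfies \<open>t\<^sup>i = t\<^sup>n / t\<^sup>n\<^sup>-\<^sup>i \<le> t\<^sup>n / d\<^sup>n\<^sup>-\<^sup>i\<close>.
\<close>

lemma poly_bound_away_from_0:
  fixes q :: "real poly"
  assumes "degree q \<le> n" "d > 0"
  obtains M where "\<And>t. t \<ge> d \<Longrightarrow> \<bar>poly q t\<bar> \<le> M * t ^ n"
proof -
  have "\<bar>poly q t\<bar> \<le> (\<Sum>i\<le>degree q. \<bar>coeff q i\<bar> / d ^ (n - i)) * t ^ n" if "t \<ge> d" for t
  proof -
    have "\<bar>coeff q i * t ^ i\<bar> \<le> \<bar>coeff q i\<bar> / d ^ (n - i) * t ^ n" if "i \<le> degree q" for i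
    proof -
      have "t ^ n = t ^ (n - i) * t ^ i"
        using that assms by (simp flip: power_add)
      moreover have "d ^ (n - i) \<le> t ^ (n - i)"
        using \<open>t \<ge> d\<close> \<open>d > 0\<close> by (simp add: power_mono)
      ultimately have "d ^ (n - i) * t ^ i \<le> t ^ n"
        using \<open>t \<ge> d\<close> \<open>d > 0\<close> by (simp add: mult_right_mono)
      then have "t ^ i \<le> t ^ n / d ^ (n - i)"
        using \<open>d > 0\<close> by (simp add: field_simps)
      then show ?thesis
        using \<open>t \<ge> d\<close> \<open>d > 0\<close> mult_left_mono[of "t ^ i" "t ^ n / d ^ (n - i)" "\<bar>coeff q i\<bar>"] by (simp add: abs_mult)
    qed
    then show ?thesis
      unfolding poly_altdef sum_distrib_right
      by (intro order_trans[OF sum_abs] sum_mono) auto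
  qed
  then show ?thesis using that by blast
qed

text \<open>
  The induction strips factors \<open>t\<close> from a non-zero \<open>q\<close> until the constant coefficient \<open>c\<close> is non-zero, hence
  positive. Then \<open>q\<close> is positive up to some \<open>d > 0\<close>, and beyond \<open>d\<close> it is dominated by a multiple of
  \<open>t\<^sup>n\<close>.
\<close>

lemma poly_add_power_nonneg:
  fixes q :: "real poly"
  assumes "\<And>k. coeff q k \<noteq> 0 \<Longrightarrow> (\<And>j. j < k \<Longrightarrow> coeff q j = 0) \<Longrightarrow> coeff q k > 0"
    and "degree q \<le> n"
  shows "\<exists>M. \<forall>t\<ge>0. poly q t + M * t ^ n \<ge> 0"
  using assms
proof (induction q arbitrary: n)
  case 0
  show ?case by (intro exI[of _ 0]) simp
next
  case (pCons c q)
  show ?case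
  proof (cases "c = 0")
    case True
    then have "q \<noteq> 0" using pCons.hyps by simp
    then obtain n' where n: "n = Suc n'" "degree q \<le> n'"
      using pCons.prems(2) by (cases n) auto
    have "coeff q k > 0" if "coeff q k \<noteq> 0" "\<And>j. j < k \<Longrightarrow> coeff q j = 0" for k
      using pCons.prems(1)[of "Suc k"] that True by (auto simp: coeff_pCons split: nat.splits)
    then obtain M where M: "\<And>t. t \<ge> 0 \<Longrightarrow> poly q t + M * t ^ n' \<ge> 0"
      using pCons.IH[OF _ n(2)] by blast
    have "poly (pCons c q) t + M * t ^ n \<ge> 0" if "t \<ge> 0" for t
      using mult_nonneg_nonneg[OF that M[OF that]] True n by (simp add: algebra_simps)
    then show ?thesis by blast
  next
    case False
    let ?p = "pCons c q"
    have "c > 0" using pCons.prems(1)[of 0] False by simp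
    have "isCont (poly ?p) 0" by simp
    then obtain d where d: "d > 0" "\<And>t. \<bar>t\<bar> < d \<Longrightarrow> \<bar>poly ?p t - c\<bar> < c"
      unfolding continuous_at_eps_delta using \<open>c > 0\<close> by (fastforce simp: dist_real_def)
    obtain M where M: "\<And>t. t \<ge> d \<Longrightarrow> \<bar>poly ?p t\<bar> \<le> M * t ^ n"
      using poly_bound_away_from_0[OF pCons.prems(2) d(1)] by blast
    have "poly ?p t + \<bar>M\<bar> * t ^ n \<ge> 0" if "t \<ge> 0" for t
    proof (cases "t < d")
      case True
      then have "poly ?p t > 0" using d(2)[of t] that by linarith
      then show ?thesis using that by (simp add: add_nonneg_nonneg less_imp_le del: poly_pCons)
    next
      case False
      then have "- poly ?p t \<le> M * t ^ n"
        using M[of t] by linarith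
      also have "\<dots> \<le> \<bar>M\<bar> * t ^ n"
        using that by (intro mult_right_mono) auto
      finally show ?thesis by linarith
    qed
    then show ?thesis by blast
  qed
qed

text \<open>
  The witness is \<open>P(x - c)\<close> with \<open>P(t) = \<Sum>\<^sub>k d k t\<^sup>k / k! + M t\<^sup>m\<^sup>+\<^sup>1 / (m (m + 1))\<close>. The last
  term leaves the derivatives of order up to \<open>m\<close> at \<open>0\<close> unchanged and adds \<open>M t\<^sup>m\<^sup>-\<^sup>1\<close> to the second
  derivative. The hypothesis speaks of signs alone so that it can be met both by the data at a right
  end point and by the reflected data of a left one.
\<close>

lemma convex_jet_extending_right:
  assumes "m \<ge> 2" and d: "\<And>k. k \<in> {2..m} \<Longrightarrow> d k \<noteq> 0 \<Longrightarrow> (\<And>j. j \<in> {2..<k} \<Longrightarrow> d j = 0) \<Longrightarrow> d k > 0"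
  obtains G where "jet_on m UNIV G" "\<And>k. k \<le> m \<Longrightarrow> G k c = d k" "\<And>x. x \<ge> c \<Longrightarrow> G 2 x \<ge> 0"
proof -
  define T :: "real poly" where "T = (\<Sum>k\<le>m. monom (d k / fact k) k)"
  have coeff_T: "coeff T k = (if k \<le> m then d k / fact k else 0)" for k
    by (simp add: T_def coeff_sum)
  define q where "q = (pderiv ^^ 2) T"
  have coeff_q: "coeff q k = (if k + 2 \<le> m then d (k + 2) / fact k else 0)" for k
    by (simp add: q_def numeral_2_eq_2 coeff_pderiv coeff_T del: of_nat_Suc)
  have "degree q \<le> m - 1"
    by (rule degree_le) (auto simp: coeff_q)
  moreover have "coeff q k > 0" if "coeff q k \<noteq> 0" "\<And>j. j < k \<Longrightarrow> coeff q j = 0" for k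
  proof -
    note low = that(2)
    have k: "k + 2 \<le> m" "d (k + 2) \<noteq> 0" using that(1) by (auto simp: coeff_q split: if_splits)
    moreover have "d j = 0" if j: "j \<in> {2..<k + 2}" for j
    proof -
      obtain i where "j = i + 2" using j le_Suc_ex[of 2 j] by (auto simp: add.commute)
      then show ?thesis
        using low[of i] j k by (simp add: coeff_q)
    qed
    ultimately show ?thesis using d[of "k + 2"] by (simp add: coeff_q)
  qed
  ultimately obtain M where M: "\<And>t. t \<ge> 0 \<Longrightarrow> poly q t + M * t ^ (m - 1) \<ge> 0"
    using poly_add_power_nonneg[of q "m - 1"] by blast
  define P where "P = T + monom (M / Suc m / m) (Suc m)"
  have P'': "(pderiv ^^ 2) P = q + monom M (m - 1)"
    using \<open>m \<ge> 2\<close> by (simp add: P_def q_def numeral_2_eq_2 pderiv_add pderiv_monom del: of_nat_Suc)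
  show ?thesis
  proof
    show "jet_on m UNIV (\<lambda>k x. poly ((pderiv ^^ k) P) (x - c))"
      by (rule jet_on_poly)
    show "poly ((pderiv ^^ k) P) (c - c) = d k" if "k \<le> m" for k
    proof -
      have "coeff P k = d k / fact k"
        using that by (simp add: P_def coeff_T)
      then show ?thesis
        by (simp add: poly_0_coeff_0 coeff_higher_pderiv pochhammer_fact[symmetric, of k])
    qed
    show "poly ((pderiv ^^ 2) P) (x - c) \<ge> 0" if "x \<ge> c" for x
      using M[of "x - c"] that unfolding P'' by (simp add: poly_monom)
  qed
qed

text \<open>
  The reflected data are \<open>(-1)\<^sup>k d k\<close>; the first non-zero one is still positive because its order is even.
\<close>

lemma convex_jet_extending_left:
  assumes "m \<ge> 2" and d: "first_nonzero_pos_even m d"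
  obtains G where "jet_on m UNIV G" "\<And>k. k \<le> m \<Longrightarrow> G k c = d k" "\<And>x. x \<le> c \<Longrightarrow> G 2 x \<ge> 0"
proof -
  have "(-1) ^ k * d k > 0"
    if "k \<in> {2..m}" "(-1) ^ k * d k \<noteq> 0" "\<And>j. j \<in> {2..<k} \<Longrightarrow> (-1) ^ j * d j = 0" for k
    using d that by (force simp: first_nonzero_pos_even_def)
  then obtain G where G: "jet_on m UNIV G" "\<And>k. k \<le> m \<Longrightarrow> G k (- c) = (-1) ^ k * d k"
      "\<And>x. x \<ge> - c \<Longrightarrow> G 2 x \<ge> 0"
    using convex_jet_extending_right[OF \<open>m \<ge> 2\<close>, of "\<lambda>k. (-1) ^ k * d k" "- c"] by blast
  show ?thesis
  proof
    show "jet_on m UNIV (\<lambda>k x. (-1) ^ k * G k (- x))"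
      by (rule jet_on_reflect[OF G(1)])
  qed (use G in \<open>auto simp flip: mult.assoc power_add mult_2\<close>)
qed

section \<open>The extension theorem\<close>

theorem proposition1p4:
  fixes f :: "real \<Rightarrow> real" and a b :: real and m :: nat
  assumes "a < b" and "m \<ge> 2"
    and "convex_on {a..b} f"
    and "C_class_on m {a<..<b} f"
    and "right_derivs_exist f m a" and "right_deriv_continuous f m a"
    and "left_derivs_exist f m b" and "left_deriv_continuous f m b"
  shows "(\<exists>F. convex_on UNIV F \<and> C_class_on m UNIV F \<and> (\<forall>x\<in>{a..b}. F x = f x)) \<longleftrightarrow>
         first_nonzero_pos_even m (\<lambda>k. left_deriv f k b) \<and>
         first_nonzero_pos_even m (\<lambda>k. right_deriv f k a)"
    (is "?extends \<longleftrightarrow> ?left \<and> ?right")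
proof -
  define D where "D = closed_interval_jet f a b"
  have D: "jet_on m {a..b} D"
    unfolding D_def by (rule jet_on_closed_interval_jet) (use assms in auto)
  have D_a: "D k a = right_deriv f k a" and D_b: "D k b = left_deriv f k b" for k
    using \<open>a < b\<close> by (auto simp: D_def closed_interval_jet_def)
  have D_0: "D 0 = f"
    by (auto simp: D_def closed_interval_jet_def)
  have D_2: "D 2 x \<ge> 0" if x: "x \<in> {a<..<b}" for x
  proof (rule convex_on_imp_second_deriv_nonneg)
    show "convex_on {a<..<b} f"
      using \<open>convex_on {a..b} f\<close> by (rule convex_on_subset) auto
    have DJ: "jet_on m {a<..<b} D"
      by (rule jet_on_subset[OF D]) auto
    show "(f has_real_derivative D 1 y) (at y)" if "y \<in> {a<..<b}" for y
      using jet_onD[OF DJ _ that, of 0] that \<open>m \<ge> 2\<close>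
      by (simp add: D_0 at_within_open_NO_MATCH)
    show "(D 1 has_real_derivative D 2 x) (at x)"
      using jet_onD[OF DJ _ x, of 1] x \<open>m \<ge> 2\<close>
      by (simp add: at_within_open_NO_MATCH numeral_2_eq_2)
  qed (use x in auto)
  show ?thesis
  proof
    assume ?extends
    then obtain F where F: "convex_on UNIV F" "C_class_on m UNIV F" "\<And>x. x \<in> {a..b} \<Longrightarrow> F x = f x"
      by blast
    have "jet_on m {a..b} (\<lambda>k. (deriv ^^ k) F)"
      using C_class_imp_jet_on[OF F(2)] by (rule jet_on_subset) auto
    then have same: "(deriv ^^ k) F x = D k x" if "k \<le> m" "x \<in> {a..b}" for k x
      using jet_on_Icc_unique[OF _ D \<open>a < b\<close>, of "\<lambda>k. (deriv ^^ k) F"] F(3) D_0 that by simp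
    have "first_nonzero_pos_even m (\<lambda>k. D k c)" if "c \<in> {a..b}" for c
      using convex_imp_first_nonzero_pos_even[OF \<open>m \<ge> 2\<close> F(1,2), of c] same[OF _ that]
      by (simp add: first_nonzero_pos_even_def)
    from this[of a] this[of b] show "?left \<and> ?right"
      using \<open>a < b\<close> by (simp add: D_a D_b)
  next
    assume "?left \<and> ?right"
    then obtain L R where
      L: "jet_on m UNIV L" "\<And>k. k \<le> m \<Longrightarrow> L k a = D k a" "\<And>x. x \<le> a \<Longrightarrow> L 2 x \<ge> 0" and
      R: "jet_on m UNIV R" "\<And>k. k \<le> m \<Longrightarrow> R k b = D k b" "\<And>x. x \<ge> b \<Longrightarrow> R 2 x \<ge> 0"
      using convex_jet_extending_left[OF \<open>m \<ge> 2\<close>, of "\<lambda>k. D k a" a]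
        convex_jet_extending_right[OF \<open>m \<ge> 2\<close>, of "\<lambda>k. D k b" b]
      by (smt (verit) D_a D_b first_nonzero_pos_even_def)
    define K where "K = (\<lambda>k x. if x \<in> {..a} then L k x else D k x)"
    define J where "J = (\<lambda>k x. if x \<in> {..b} then K k x else R k x)"
    have ab: "{..a} \<union> {a..b} = {..b}" using \<open>a < b\<close> by auto
    have "jet_on m ({..a} \<union> {a..b}) K"
      unfolding K_def using L(1,2) D by (intro jet_on_glue) (auto intro: jet_on_subset)
    then have "jet_on m ({..b} \<union> {b..}) J"
      unfolding J_def ab using R(1,2) \<open>a < b\<close>
      by (intro jet_on_glue) (auto intro: jet_on_subset simp: K_def)
    moreover have "{..b} \<union> {b..} = UNIV" by auto
    ultimately have J: "jet_on m UNIV J" by simp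
    \<comment> \<open>\<open>D_2\<close> covers the open interval only; at \<open>a\<close> and \<open>b\<close> the sign comes from \<open>L\<close> and \<open>R\<close>.\<close>
    have "J 2 x \<ge> 0" for x
      using L(3)[of x] R(3)[of x] R(2)[of 2] D_2[of x] \<open>m \<ge> 2\<close>
      by (cases "x = b") (auto simp: J_def K_def)
    then have "convex_on UNIV (J 0)"
      using jet_onD[OF J, of 0] jet_onD[OF J, of 1] \<open>m \<ge> 2\<close>
      by (intro f''_ge0_imp_convex[of UNIV "J 0" "J 1" "J 2"]) (auto simp: numeral_2_eq_2)
    moreover have "C_class_on m UNIV (J 0)"
      by (rule jet_on_UNIV_imp_C_class[OF J])
    moreover have "J 0 x = f x" if "x \<in> {a..b}" for x
      using that L(2)[of 0] by (auto simp: J_def K_def D_0)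
    ultimately show ?extends by blast
  qed
qed

end
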